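(* Assume $\int_{\Gamma_X^\sharp}\lambda(D_B(\gamma'))\,\mu_0(d\gamma')<\infty$ for every $B\in\mathcal B(X)$ with $\lambda(B)<\infty$ (so that $\lambda^\star$ is $\sigma$-finite), and let $\pi_{\lambda^\star}$ be the Poisson measure on $\Gamma_{\mathfrak X}^\sharp$ with intensity $\lambda^\star$. Then the map $\mathfrak p:\Gamma^\sharp_{\mathfrak X}\to\Gamma_X^\sharp$, $\mathfrak p(\bar\gamma)=\sum_{\bar x\in\bar\gamma}\mathfrak p(\bar x)$, is measurable and $\pi_{\lambda^\star}\circ\mathfrak p^{-1}=\mu_{\mathrm{cl}}$.
   Context: Let $X$ be a Polish space which is also a real topological vector space. For a measurable space $Y$, a generalized configuration is a $\overline{\mathbb Z}_+$-valued measure $\gamma=\sum_i\delta_{x_i}$ on $Y$ with countably many (not necessarily distinct) points; $\Gamma_Y^\sharp$ is their space with the $\sigma$-algebra generated by $\gamma\mapsto\gamma(B)$; $\langle f,\gamma\rangle=\sum_{x\in\gamma}f(x)$. For a $\sigma$-finite measure $\sigma$ on $Y$, the Poisson measure $\pi_\sigma$ on $\Gamma_Y^\sharp$ is the probability measure with $\int e^{-\langle f,\gamma\rangle}d\pi_\sigma=\exp\{-\int(1-e^{-f})d\sigma\}$ for measurable $f\ge0$. $\mathfrak X=\bigsqcup_{n\in\overline{\mathbb Z}_+}X^n$ ($X^0=\{\emptyset\}$, $X^\infty$ sequences) with disjoint-union Borel structure, $\mathfrak p(x_1,x_2,\dots)=\sum_i\delta_{x_i}\in\Gamma_X^\sharp$,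 $\bar y+x=(y_1+x,y_2+x,\dots)$. $\lambda$ is a $\sigma$-finite measure on $X$, $\eta$ a permutation-symmetric probability measure on $\mathfrak X$, $\mu_0=\eta\circ\mathfrak p^{-1}$ (cluster law), $\lambda^\star(B):=\int_X\eta(B-x)\lambda(dx)$. Droplet cluster $D_B(\gamma')=\bigcup_{y\in\gamma'}(B-y)$. The Poisson cluster measure $\mu_{\mathrm{cl}}$ is the probability measure on $\Gamma_X^\sharp$ with $\int e^{-\langle f,\gamma\rangle}d\mu_{\mathrm{cl}}=\exp\{-\int_X\int(1-e^{-\sum_{y\in\gamma'}f(y+x)})\mu_0(d\gamma')\lambda(dx)\}$ for all measurable $f\ge0$. *)

theory Defs
  imports "HOL-Probability.Probability"
begin

text \<open>A generalized configuration on a measurable space Y (with measurable singletons,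
  as is the case for the standard Borel spaces used below) is represented by its
  multiplicity function c : Y \<Rightarrow> enat with countable support contained in the space;
  it corresponds to the measure gamma(B) = sum over y in B of c y.\<close>

definition gconf :: "'b measure \<Rightarrow> ('b \<Rightarrow> enat) set" where
  "gconf Y = {c. countable {y. c y \<noteq> 0} \<and> {y. c y \<noteq> 0} \<subseteq> space Y}"

definition gcount :: "('b \<Rightarrow> enat) \<Rightarrow> 'b set \<Rightarrow> ennreal" where
  "gcount c B = (\<integral>\<^sup>+ y. ennreal_of_enat (c y) * indicator B y \<partial>count_space UNIV)"

definition gpair :: "('b \<Rightarrow> enat) \<Rightarrow> ('b \<Rightarrow> real) \<Rightarrow> ennreal" where
  "gpair c f = (\<integral>\<^sup>+ y. ennreal_of_enat (c y) * ennreal (f y) \<partial>count_space UNIV)"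

definition Gamma :: "'b measure \<Rightarrow> ('b \<Rightarrow> enat) measure" where
  "Gamma Y = sigma (gconf Y)
     {{c \<in> gconf Y. gcount c B \<in> A} | B A. B \<in> sets Y \<and> A \<in> sets (borel :: ennreal measure)}"

definition nexp :: "ennreal \<Rightarrow> real" where
  "nexp t = (if t = \<infinity> then 0 else exp (- enn2real t))"

text \<open>Poisson measure on Gamma Y with intensity sig (characterised by its Laplace functional).\<close>
definition is_poisson :: "'b measure \<Rightarrow> 'b measure \<Rightarrow> ('b \<Rightarrow> enat) measure \<Rightarrow> bool" where
  "is_poisson Y sig P \<longleftrightarrow> prob_space P \<and> sets P = sets (Gamma Y) \<and>
     (\<forall>f \<in> borel_measurable Y. (\<forall>y. 0 \<le> f y) \<longrightarrow>
        (\<integral>\<^sup>+ c. ennreal (nexp (gpair c f)) \<partial>P)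
          = ennreal (nexp (\<integral>\<^sup>+ y. ennreal (1 - exp (- f y)) \<partial>sig)))"

text \<open>An element of the disjoint union of X^n (n in {0,1,...,\<infinity>}) is represented as
  (n, x) with x i = 0 for all i \<ge> n.\<close>

definition XXspace :: "(enat \<times> (nat \<Rightarrow> 'a::zero)) set" where
  "XXspace = {(n, x). \<forall>i. n \<le> enat i \<longrightarrow> x i = 0}"

definition XXM :: "(enat \<times> (nat \<Rightarrow> 'a::{zero,topological_space})) measure" where
  "XXM = restrict_space (count_space UNIV \<Otimes>\<^sub>M (\<Pi>\<^sub>M i\<in>(UNIV::nat set). borel)) XXspace"

text \<open>p(x_1, x_2, ...) = sum of Dirac masses at x_i\<close>
definition pt :: "enat \<times> (nat \<Rightarrow> 'a) \<Rightarrow> 'a \<Rightarrow> enat" where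
  "pt xb y = (let S = {i. enat i < fst xb \<and> snd xb i = y} in
              if finite S then enat (card S) else \<infinity>)"

definition ppmap :: "(enat \<times> (nat \<Rightarrow> 'a) \<Rightarrow> enat) \<Rightarrow> 'a \<Rightarrow> enat" where
  "ppmap cb y = (SUP F \<in> {F. finite F}. \<Sum>xb\<in>F. cb xb * pt xb y)"

definition shift :: "enat \<times> (nat \<Rightarrow> 'a::real_vector) \<Rightarrow> 'a \<Rightarrow> enat \<times> (nat \<Rightarrow> 'a)" where
  "shift yb x = (fst yb, \<lambda>i. if enat i < fst yb then snd yb i + x else 0)"

definition perm_on :: "enat \<Rightarrow> (nat \<Rightarrow> nat) \<Rightarrow> enat \<times> (nat \<Rightarrow> 'a) \<Rightarrow> enat \<times> (nat \<Rightarrow> 'a)" where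
  "perm_on n p xb = (if fst xb = n then (fst xb, snd xb \<circ> p) else xb)"

definition perm_symmetric :: "(enat \<times> (nat \<Rightarrow> 'a::{zero,topological_space})) measure \<Rightarrow> bool" where
  "perm_symmetric eta \<longleftrightarrow>
     (\<forall>n p. bij_betw p {i. enat i < n} {i. enat i < n} \<and> (\<forall>i. n \<le> enat i \<longrightarrow> p i = i)
            \<and> finite {i. p i \<noteq> i} \<longrightarrow> distr eta XXM (perm_on n p) = eta)"

definition lamstar :: "'a measure \<Rightarrow> (enat \<times> (nat \<Rightarrow> 'a::{real_vector,topological_space})) measure
    \<Rightarrow> (enat \<times> (nat \<Rightarrow> 'a)) measure" where
  "lamstar lam eta = measure_of (space XXM) (sets XXM)
     (\<lambda>B. \<integral>\<^sup>+ x. emeasure eta {yb \<in> space XXM. shift yb x \<in> B} \<partial>lam)"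

definition droplet :: "'a::real_vector set \<Rightarrow> ('a \<Rightarrow> enat) \<Rightarrow> 'a set" where
  "droplet B c = (\<Union>y \<in> {y. c y \<noteq> 0}. {x. x + y \<in> B})"

definition is_cluster :: "'a measure \<Rightarrow> ('a \<Rightarrow> enat) measure \<Rightarrow> ('a::{real_vector,topological_space} \<Rightarrow> enat) measure \<Rightarrow> bool" where
  "is_cluster lam mu0 M \<longleftrightarrow> prob_space M \<and> sets M = sets (Gamma (borel :: 'a measure)) \<and>
     (\<forall>f \<in> borel_measurable (borel :: 'a measure). (\<forall>y. 0 \<le> f y) \<longrightarrow>
        (\<integral>\<^sup>+ c. ennreal (nexp (gpair c f)) \<partial>M)
          = ennreal (nexp (\<integral>\<^sup>+ x. \<integral>\<^sup>+ c'. ennreal (1 - nexp (gpair c' (\<lambda>y. f (y + x)))) \<partial>mu0 \<partial>lam)))"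

end

theory Submission
  imports Defs
begin

text \<open>Pairing \<open>ppmap c\<close> with f is the same as pairing c with the function sending x to the
  pairing of \<open>pt x\<close> with f. The intensity \<open>lamstar lam eta\<close> is the image of the product of lam
  and eta under the shift map, so the Laplace functional of the Poisson measure, extended to test
  functions with values in [0, \<infinity>], turns into the one of the cluster measure. The Laplace functional
  determines a law on configurations because counts are integers: the event N = n is read off from
  the Laplace transform of N by multiplying it by exp(kn), after subtracting the contributions of
  N < n, and letting k tend to infinity.\<close>

section \<open>Pairing a configuration with an extended test function\<close>

text \<open>Values in [0, infinity] cover \<open>gpair\<close> and \<open>gcount\<close> at once and
  admit test functions that are themselves pairings: \<open>gint (pt x) g\<close>, as a function of
  the cluster x, may be infinite even for finite g.\<close>

definition gint :: "('b \<Rightarrow> enat) \<Rightarrow> ('b \<Rightarrow> ennreal) \<Rightarrow> ennreal" where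
  "gint c g = (\<integral>\<^sup>+ y. ennreal_of_enat (c y) * g y \<partial>count_space UNIV)"

lemma gpair_eq_gint: "gpair c f = gint c (\<lambda>y. ennreal (f y))"
  by (simp add: gpair_def gint_def)

lemma gcount_eq_gint: "gcount c B = gint c (indicator B)"
  by (simp add: gcount_def gint_def)

lemma gint_add: "gint c (\<lambda>y. f y + g y) = gint c f + gint c g"
  by (simp add: gint_def distrib_left nn_integral_add)

lemma gint_cmult: "gint c (\<lambda>y. a * g y) = a * gint c g"
  by (simp add: gint_def nn_integral_cmult[symmetric] mult.left_commute)

lemma gint_SUP:
  assumes "incseq U"
  shows "gint c (\<lambda>y. SUP k. U k y) = (SUP k::nat. gint c (U k))"
proof -
  have "gint c (\<lambda>y. SUP k. U k y) = (\<integral>\<^sup>+ y. (SUP k. ennreal_of_enat (c y) * U k y) \<partial>count_space UNIV)"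
    by (simp add: gint_def SUP_mult_left_ennreal)
  also have "\<dots> = (SUP k. gint c (U k))"
    unfolding gint_def using assms
    by (intro nn_integral_monotone_convergence_SUP) (auto simp: incseq_def le_fun_def intro!: mult_left_mono)
  finally show ?thesis .
qed

section \<open>Sums over countable supports and integrality of counts\<close>

text \<open>Enumerating the support gives increasing finite sets \<open>T k\<close>, and monotone
  convergence along them bounds the integral by finite sums. The supremum over finite sets is the
  form in which \<open>ppmap\<close> is defined.\<close>

lemma nn_integral_count_space_SUP_finite:
  fixes f :: "'b \<Rightarrow> ennreal"
  assumes "countable {y. f y \<noteq> 0}"
  shows "(\<integral>\<^sup>+ y. f y \<partial>count_space UNIV) = (SUP F\<in>{F. finite F}. sum f F)"
proof (rule antisym)
  define S where "S = {y. f y \<noteq> 0}"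
  define T where "T k = from_nat_into S ` {..<k}" for k :: nat
  show "(\<integral>\<^sup>+ y. f y \<partial>count_space UNIV) \<le> (SUP F\<in>{F. finite F}. sum f F)"
  proof (cases "S = {}")
    case True
    then have "f y = 0" for y by (auto simp: S_def)
    then show ?thesis by simp
  next
    case False
    have f_eq: "f y = (SUP k. f y * indicator (T k) y)" for y
    proof (cases "y \<in> S")
      case True
      then obtain n where "from_nat_into S n = y"
        using assms False unfolding S_def by (metis from_nat_into_surj)
      then have "y \<in> T (Suc n)" by (auto simp: T_def)
      then show ?thesis
        by (intro antisym SUP_upper2[of "Suc n"] SUP_least) (auto split: split_indicator)
    qed (simp add: S_def)
    have inc: "incseq (\<lambda>k y. f y * indicator (T k) y)"
      by (auto simp: incseq_def le_fun_def T_def intro!: mult_left_mono split: split_indicator)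
    have "(\<integral>\<^sup>+ y. f y \<partial>count_space UNIV) = (SUP k. \<integral>\<^sup>+ y. f y * indicator (T k) y \<partial>count_space UNIV)"
      by (subst f_eq, intro nn_integral_monotone_convergence_SUP inc) auto
    also have "\<dots> = (SUP k. sum f (T k))"
    proof (intro SUP_cong refl)
      fix k
      show "(\<integral>\<^sup>+ y. f y * indicator (T k) y \<partial>count_space UNIV) = sum f (T k)"
        by (subst nn_integral_count_space'[where A="T k"]) (auto simp: T_def)
    qed
    also have "\<dots> \<le> (SUP F\<in>{F. finite F}. sum f F)"
      by (intro SUP_mono) (auto simp: T_def)
    finally show ?thesis .
  qed
  show "(SUP F\<in>{F. finite F}. sum f F) \<le> (\<integral>\<^sup>+ y. f y \<partial>count_space UNIV)"
  proof (intro SUP_least, clarsimp)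
    fix F :: "'b set" assume "finite F"
    then have "sum f F = (\<integral>\<^sup>+ y. f y * indicator F y \<partial>count_space UNIV)"
      by (subst nn_integral_count_space'[where A="F"]) auto
    also have "\<dots> \<le> (\<integral>\<^sup>+ y. f y \<partial>count_space UNIV)"
      by (intro nn_integral_mono) (auto split: split_indicator)
    finally show "sum f F \<le> (\<integral>\<^sup>+ y. f y \<partial>count_space UNIV)" .
  qed
qed

lemma ennreal_of_enat_mult: "ennreal_of_enat (a * b) = ennreal_of_enat a * ennreal_of_enat b"
  by (cases a; cases b) (auto simp: ennreal_top_mult ennreal_mult_top imult_is_infinity
      top_unique zero_enat_def enat_0_iff ennreal_of_enat_def)

text \<open>\<open>ennreal_of_enat\<close> respects finite sums and suprema, so the whole sum can be
  formed inside \<open>enat\<close>; this is why counts are integers or infinity.\<close>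

lemma nn_integral_count_space_enat:
  fixes h :: "'b \<Rightarrow> enat"
  assumes "countable {y. h y \<noteq> 0}"
  shows "(\<integral>\<^sup>+ y. ennreal_of_enat (h y) \<partial>count_space UNIV)
    = ennreal_of_enat (SUP F\<in>{F. finite F}. sum h F)"
proof -
  have "{y. ennreal_of_enat (h y) \<noteq> 0} = {y. h y \<noteq> 0}"
    using ennreal_of_enat_inj[of _ 0] by auto
  then show ?thesis
    using assms by (subst nn_integral_count_space_SUP_finite)
      (simp_all add: ennreal_of_enat_Sup image_image)
qed

lemma gcount_integer:
  assumes "c \<in> gconf Y"
  shows "gcount c B = \<infinity> \<or> (\<exists>n::nat. gcount c B = of_nat n)"
proof -
  have "gcount c B = (\<integral>\<^sup>+ y. ennreal_of_enat (c y * indicator B y) \<partial>count_space UNIV)"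
    unfolding gcount_def by (intro nn_integral_cong) (auto split: split_indicator)
  also have "\<dots> = ennreal_of_enat (SUP F\<in>{F. finite F}. \<Sum>y\<in>F. c y * indicator B y)"
    using assms by (intro nn_integral_count_space_enat)
      (auto simp: gconf_def elim: countable_subset[rotated])
  finally show ?thesis
    by (cases "SUP F\<in>{F. finite F}. \<Sum>y\<in>F. c y * indicator B y") auto
qed

section \<open>The superposition map as a double sum\<close>

lemma ennreal_of_enat_ppmap:
  assumes "c \<in> gconf Y"
  shows "ennreal_of_enat (ppmap c y)
    = (\<integral>\<^sup>+ x. ennreal_of_enat (c x) * ennreal_of_enat (pt x y) \<partial>count_space UNIV)"
proof -
  have "countable {x. c x * pt x y \<noteq> 0}"
    using assms by (auto simp: gconf_def elim: countable_subset[rotated])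
  then show ?thesis
    unfolding ppmap_def by (simp add: nn_integral_count_space_enat[symmetric] ennreal_of_enat_mult)
qed

text \<open>Counting measure on an uncountable type is not sigma-finite, so the usual Fubini theorem
  does not apply. Instead, both iterated sums equal the integral against counting measure on
  pairs.\<close>

lemma nn_integral_count_space_swap:
  fixes f :: "'b \<Rightarrow> 'c \<Rightarrow> ennreal"
  shows "(\<integral>\<^sup>+ x. \<integral>\<^sup>+ y. f x y \<partial>count_space UNIV \<partial>count_space UNIV)
    = (\<integral>\<^sup>+ y. \<integral>\<^sup>+ x. f x y \<partial>count_space UNIV \<partial>count_space UNIV)"
  using nn_integral_fst_count_space[of "case_prod f"] nn_integral_snd_count_space[of "case_prod f"]
  by simp

text \<open>Both sides are one double sum over clusters x and points y, taken in different
  orders.\<close>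

lemma gint_ppmap:
  assumes "c \<in> gconf Y"
  shows "gint (ppmap c) g = gint c (\<lambda>x. gint (pt x) g)"
proof -
  have "gint (ppmap c) g
    = (\<integral>\<^sup>+ y. \<integral>\<^sup>+ x. ennreal_of_enat (c x) * (ennreal_of_enat (pt x y) * g y) \<partial>count_space UNIV \<partial>count_space UNIV)"
    unfolding gint_def ennreal_of_enat_ppmap[OF assms]
    by (simp add: nn_integral_multc[symmetric] mult.assoc)
  also have "\<dots> = gint c (\<lambda>x. gint (pt x) g)"
    unfolding gint_def by (subst nn_integral_count_space_swap) (simp add: nn_integral_cmult)
  finally show ?thesis .
qed

lemma ennreal_of_enat_pt:
  "ennreal_of_enat (pt x y)
    = (\<integral>\<^sup>+ i. indicator {i. enat i < fst x \<and> snd x i = y} i \<partial>count_space UNIV)"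
  by (auto simp: pt_def Let_def)

text \<open>After the sums over points and indices are exchanged, index i contributes only at y =
  \<open>snd x i\<close>. Summing over indices accounts for repeated points.\<close>

lemma gint_pt:
  "gint (pt x) g = (\<integral>\<^sup>+ i. (if enat i < fst x then g (snd x i) else 0) \<partial>count_space UNIV)"
proof -
  have "gint (pt x) g = (\<integral>\<^sup>+ y. \<integral>\<^sup>+ i. indicator {i. enat i < fst x \<and> snd x i = y} i * g y
      \<partial>count_space UNIV \<partial>count_space UNIV)"
    unfolding gint_def ennreal_of_enat_pt by (simp add: nn_integral_multc)
  also have "\<dots> = (\<integral>\<^sup>+ i. \<integral>\<^sup>+ y. indicator {i. enat i < fst x \<and> snd x i = y} i * g y
      \<partial>count_space UNIV \<partial>count_space UNIV)"
    by (rule nn_integral_count_space_swap)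
  also have "\<dots> = (\<integral>\<^sup>+ i. (if enat i < fst x then g (snd x i) else 0) \<partial>count_space UNIV)"
  proof (intro nn_integral_cong)
    fix i
    show "(\<integral>\<^sup>+ y. indicator {i. enat i < fst x \<and> snd x i = y} i * g y \<partial>count_space UNIV)
        = (if enat i < fst x then g (snd x i) else 0)"
    proof (cases "enat i < fst x")
      case True
      then have "(\<integral>\<^sup>+ y. indicator {i. enat i < fst x \<and> snd x i = y} i * g y \<partial>count_space UNIV)
          = (\<integral>\<^sup>+ y. g (snd x i) * indicator {snd x i} y \<partial>count_space UNIV)"
        by (intro nn_integral_cong) (auto split: split_indicator)
      also have "\<dots> = g (snd x i)"
        by (subst nn_integral_cmult) auto
      finally show ?thesis using True by simp
    qed simp
  qed
  finally show ?thesis .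
qed

section \<open>The sigma-algebra on configurations\<close>

lemma space_Gamma: "space (Gamma Y) = gconf Y"
  unfolding Gamma_def by (rule space_measure_of) auto

lemma gcount_measurable [measurable]:
  assumes "B \<in> sets Y"
  shows "(\<lambda>c. gcount c B) \<in> borel_measurable (Gamma Y)"
proof (rule measurableI)
  fix A :: "ennreal set" assume "A \<in> sets borel"
  then have "{c \<in> gconf Y. gcount c B \<in> A} \<in> sets (Gamma Y)"
    unfolding Gamma_def using assms by (subst sets_measure_of) (auto intro!: sigma_sets.Basic)
  then show "(\<lambda>c. gcount c B) -` A \<inter> space (Gamma Y) \<in> sets (Gamma Y)"
    by (simp add: space_Gamma vimage_def Int_def conj_commute)
qed simp

lemma gint_cong:
  assumes "c \<in> gconf Y" "\<And>y. y \<in> space Y \<Longrightarrow> f y = g y"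
  shows "gint c f = gint c g"
  unfolding gint_def
proof (intro nn_integral_cong)
  fix y show "ennreal_of_enat (c y) * f y = ennreal_of_enat (c y) * g y"
    using assms by (cases "c y = 0") (auto simp: gconf_def)
qed

text \<open>For indicators the pairing is a generating count; the property then passes to scalings,
  sums and increasing limits.\<close>

lemma gint_measurable:
  assumes "g \<in> borel_measurable Y"
  shows "(\<lambda>c. gint c g) \<in> borel_measurable (Gamma Y)"
  using assms
proof (induction g rule: borel_measurable_induct)
  case (cong f g)
  have "(\<lambda>c. gint c f) \<in> borel_measurable (Gamma Y) \<longleftrightarrow> (\<lambda>c. gint c g) \<in> borel_measurable (Gamma Y)"
    using cong by (intro measurable_cong gint_cong[of _ Y]) (auto simp: space_Gamma)
  then show ?case using cong by simp
next
  case (set A)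
  then show ?case by (simp add: gcount_eq_gint[symmetric])
next
  case (mult u a)
  then show ?case by (simp add: gint_cmult)
next
  case (add u v)
  then show ?case by (simp add: gint_add)
next
  case (seq U)
  then show ?case by (simp add: gint_SUP image_image SUP_apply[abs_def])
qed

lemma measurable_into_Gamma:
  assumes "\<And>x. x \<in> space M \<Longrightarrow> f x \<in> gconf Y"
    and "\<And>B. B \<in> sets Y \<Longrightarrow> (\<lambda>x. gcount (f x) B) \<in> borel_measurable M"
  shows "f \<in> measurable M (Gamma Y)"
  unfolding Gamma_def
proof (rule measurable_measure_of)
  fix Z assume "Z \<in> {{c \<in> gconf Y. gcount c B \<in> A} | B A. B \<in> sets Y \<and> A \<in> sets (borel :: ennreal measure)}"
  then obtain B A where Z: "Z = {c \<in> gconf Y. gcount c B \<in> A}"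
    and [measurable]: "B \<in> sets Y" "A \<in> sets borel" by auto
  have [measurable]: "(\<lambda>x. gcount (f x) B) \<in> borel_measurable M" by (rule assms) fact
  have "f -` Z \<inter> space M = {x \<in> space M. gcount (f x) B \<in> A}"
    using assms(1) by (auto simp: Z)
  also have "\<dots> \<in> sets M" by measurable
  finally show "f -` Z \<inter> space M \<in> sets M" .
qed (use assms in auto)

section \<open>The Laplace kernel on [0, infinity]\<close>

lemma nexp_infinity [simp]: "nexp \<infinity> = 0" "nexp \<top> = 0"
  by (auto simp: nexp_def)

lemma nexp_0 [simp]: "nexp 0 = 1"
  by (simp add: nexp_def)

lemma nexp_ennreal: "0 \<le> r \<Longrightarrow> nexp (ennreal r) = exp (- r)"
  by (simp add: nexp_def)

lemma nexp_nonneg [simp]: "0 \<le> nexp t"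
  by (simp add: nexp_def)

lemma nexp_le_1 [simp]: "nexp t \<le> 1"
  by (simp add: nexp_def)

lemma nexp_add: "nexp (s + t) = nexp s * nexp t"
  by (cases s; cases t)
    (auto simp: nexp_ennreal ennreal_plus[symmetric] exp_add[symmetric] simp del: ennreal_plus)

lemma nexp_antimono: "s \<le> t \<Longrightarrow> nexp t \<le> nexp s"
  by (cases s; cases t) (auto simp: nexp_ennreal top_unique)

lemma nexp_measurable [measurable]: "nexp \<in> borel_measurable borel"
  unfolding nexp_def[abs_def] by measurable

text \<open>The limit point infinity needs its own argument: \<open>enn2real\<close> sends infinity
  to 0, so the formula with exp alone would jump to 1 there.\<close>

lemma tendsto_nexp:
  assumes "(X \<longlongrightarrow> t) F"
  shows "((\<lambda>k. nexp (X k)) \<longlongrightarrow> nexp t) F"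
proof (cases "t = \<infinity>")
  case True
  show ?thesis
  proof (rule tendstoI)
    fix e :: real assume "e > 0"
    \<comment> \<open>Beyond the threshold \<open>- ln e\<close> the exponential drops below e. The
      maximum with 0 keeps the threshold nonnegative when e > 1, as the passage from
      \<open>ennreal\<close> back to real inequalities requires.\<close>
    have "ennreal (max 0 (- ln e)) < t" using True by simp
    then have "\<forall>\<^sub>F k in F. ennreal (max 0 (- ln e)) < X k"
      by (rule order_tendstoD(1)[OF assms])
    then show "\<forall>\<^sub>F k in F. dist (nexp (X k)) (nexp t) < e"
    proof eventually_elim
      case (elim k)
      show ?case
      proof (cases "X k")
        case (real r)
        then have "max 0 (- ln e) < r" using elim by (metis ennreal_less_iff max.cobounded1)
        then have "exp (- r) < exp (ln e)" by simp
        then show ?thesis using real True \<open>e > 0\<close> by (simp add: nexp_ennreal)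
      qed (use True \<open>e > 0\<close> in simp)
    qed
  qed
next
  case False
  then have fin: "t < \<infinity>" by (simp add: top.not_eq_extremum)
  have "((\<lambda>k. exp (- enn2real (X k))) \<longlongrightarrow> exp (- enn2real t)) F"
    using assms fin by (intro tendsto_intros) auto
  moreover have "\<forall>\<^sub>F k in F. X k < \<infinity>"
    by (rule order_tendstoD(2)[OF assms fin])
  then have "\<forall>\<^sub>F k in F. exp (- enn2real (X k)) = nexp (X k)"
    by eventually_elim (auto simp: nexp_def)
  ultimately show ?thesis
    using False by (simp add: nexp_def[of t] tendsto_cong)
qed

lemma SUP_min_of_nat: "(SUP k::nat. min a (of_nat k)) = (a::ennreal)"
proof (rule antisym)
  show "a \<le> (SUP k::nat. min a (of_nat k))"
  proof (rule ccontr)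
    assume "\<not> ?thesis"
    then have less: "(SUP k::nat. min a (of_nat k)) < a" by simp
    then obtain k :: nat where "(SUP k::nat. min a (of_nat k)) < of_nat k"
      using ennreal_Ex_less_of_nat top.not_eq_extremum by (metis top_greatest order_less_le_trans infinity_ennreal_def)
    moreover have "min a (of_nat k) \<le> (SUP k::nat. min a (of_nat k))"
      by (rule SUP_upper) simp
    ultimately show False using less by (simp add: min_def split: if_splits)
  qed
qed (auto intro: SUP_least)

section \<open>The Poisson Laplace functional at extended test functions\<close>

text \<open>\<open>is_poisson\<close> tests only real-valued functions. The truncations min(g, k)
  are real-valued and increase to g, and both sides pass to the limit.\<close>

lemma poisson_laplace_ennreal:
  assumes P: "is_poisson Y sig P" and sig: "sets sig = sets Y"
    and g: "g \<in> borel_measurable Y"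
  shows "(\<integral>\<^sup>+ c. ennreal (nexp (gint c g)) \<partial>P)
    = ennreal (nexp (\<integral>\<^sup>+ y. ennreal (1 - nexp (g y)) \<partial>sig))"
proof -
  have prob: "prob_space P" and setsP: "sets P = sets (Gamma Y)"
    using P by (auto simp: is_poisson_def)
  interpret prob_space P by fact
  note [measurable] = g
  have [measurable_cong]: "sets sig = sets Y" "sets P = sets (Gamma Y)" by fact+
  define u where "u k y = min (g y) (of_nat k)" for k :: nat and y
  define f where "f k y = enn2real (u k y)" for k y
  have f_u: "ennreal (f k y) = u k y" for k y
    unfolding f_def u_def by (rule ennreal_enn2real) (auto simp: min_less_iff_disj of_nat_less_top)
  have u_meas [measurable]: "u k \<in> borel_measurable Y" for k
    unfolding u_def[abs_def] by measurable
  have u_inc: "incseq u"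
    unfolding incseq_def le_fun_def u_def by (auto intro: min.coboundedI2 min.mono)
  have u_SUP: "(\<lambda>y. SUP k. u k y) = g"
    by (simp add: u_def SUP_min_of_nat)
  have u_lim: "(\<lambda>k. u k y) \<longlonglongrightarrow> g y" for y
    using LIMSEQ_SUP[of "\<lambda>k. u k y"] u_inc u_SUP by (auto simp: incseq_def le_fun_def fun_eq_iff)
  have gint_inc: "incseq (\<lambda>k. gint c (u k))" for c
    using u_inc unfolding incseq_def le_fun_def gint_def
    by (auto intro!: nn_integral_mono mult_left_mono)
  have gint_lim: "(\<lambda>k. gint c (u k)) \<longlonglongrightarrow> gint c g" for c
    using LIMSEQ_SUP[OF gint_inc, of c] gint_SUP[OF u_inc, of c] by (simp add: u_SUP)
  have [measurable]: "(\<lambda>c. gint c (u k)) \<in> borel_measurable P" "(\<lambda>c. gint c g) \<in> borel_measurable P" for k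
    using gint_measurable[OF u_meas] gint_measurable[OF g] setsP by (simp_all cong: measurable_cong_sets)
  have eq: "(\<integral>\<^sup>+ c. ennreal (nexp (gint c (u k))) \<partial>P)
    = ennreal (nexp (\<integral>\<^sup>+ y. ennreal (1 - nexp (u k y)) \<partial>sig))" for k
  proof -
    have "f k \<in> borel_measurable Y" "\<forall>y. 0 \<le> f k y"
      unfolding f_def[abs_def] by auto
    then have "(\<integral>\<^sup>+ c. ennreal (nexp (gpair c (f k))) \<partial>P)
        = ennreal (nexp (\<integral>\<^sup>+ y. ennreal (1 - exp (- f k y)) \<partial>sig))"
      using P unfolding is_poisson_def by blast
    moreover have "exp (- f k y) = nexp (u k y)" for y
      by (subst f_u[symmetric], subst nexp_ennreal) (auto simp: f_def)
    ultimately show ?thesis by (simp add: gpair_eq_gint f_u)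
  qed
  have "(\<lambda>k. \<integral>\<^sup>+ c. ennreal (nexp (gint c (u k))) \<partial>P) \<longlonglongrightarrow> (\<integral>\<^sup>+ c. ennreal (nexp (gint c g)) \<partial>P)"
    by (rule nn_integral_dominated_convergence[where w="\<lambda>_. 1"])
      (auto simp: emeasure_space_1 intro!: tendsto_ennrealI tendsto_nexp gint_lim)
  \<comment> \<open>The integral against \<open>sig\<close> may be infinite, so monotone convergence
    is used here, and continuity of \<open>nexp\<close> up to infinity carries the limit through the
    exponential.\<close>
  moreover have "(\<lambda>k. \<integral>\<^sup>+ y. ennreal (1 - nexp (u k y)) \<partial>sig) \<longlonglongrightarrow> (\<integral>\<^sup>+ y. ennreal (1 - nexp (g y)) \<partial>sig)"
    using u_inc by (intro nn_integral_LIMSEQ)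
      (auto simp: incseq_def le_fun_def intro!: ennreal_leI diff_left_mono nexp_antimono tendsto_intros tendsto_nexp u_lim)
  then have "(\<lambda>k. ennreal (nexp (\<integral>\<^sup>+ y. ennreal (1 - nexp (u k y)) \<partial>sig)))
      \<longlonglongrightarrow> ennreal (nexp (\<integral>\<^sup>+ y. ennreal (1 - nexp (g y)) \<partial>sig))"
    by (intro tendsto_ennrealI tendsto_nexp)
  ultimately show ?thesis
    unfolding eq by (rule LIMSEQ_unique)
qed

section \<open>Uniqueness of laws from Laplace functionals\<close>

text \<open>The weight h carries a Laplace factor and events already extracted, so that the
  extraction can be repeated for several counts jointly.\<close>

lemma (in prob_space) laplace_extract_atom:
  fixes N :: "'a \<Rightarrow> ennreal" and h :: "'a \<Rightarrow> real"
  assumes [measurable]: "N \<in> borel_measurable M" "h \<in> borel_measurable M"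
    and h: "\<And>x. 0 \<le> h x" "\<And>x. h x \<le> 1"
    and N: "\<And>x. x \<in> space M \<Longrightarrow> N x = \<infinity> \<or> (\<exists>n::nat. N x = of_nat n)"
  shows "(\<lambda>k. exp (real (Suc k) * real n) * ((\<integral>x. h x * nexp (of_nat (Suc k) * N x) \<partial>M)
      - (\<Sum>m<n. exp (- (real (Suc k) * real m)) * (\<integral>x. h x * indicator {of_nat m} (N x) \<partial>M))))
    \<longlonglongrightarrow> (\<integral>x. h x * indicator {of_nat n} (N x) \<partial>M)"
proof -
  \<comment> \<open>\<open>r k\<close> is the integrand with h removed. The factor
    \<open>Suc k\<close> is never 0: with factor 0, the convention 0 * infinity = 0 would give
    \<open>nexp\<close> the value 1 at N = infinity, whereas that value must contribute
    nothing.\<close>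
  define r where "r k t = exp (real (Suc k) * real n) * (nexp (of_nat (Suc k) * t)
      - (\<Sum>m<n. exp (- (real (Suc k) * real m)) * indicator {of_nat m} t))" for k :: nat and t :: ennreal
  have [simp]: "r k \<top> = 0" for k
    by (simp add: r_def ennreal_mult_top)
  \<comment> \<open>For j < n the subtracted sum cancels the Laplace term; for j = n the value is 1,
    and for j > n it decays in k.\<close>
  have r_nat: "r k (of_nat j) = (if j < n then 0 else exp (real (Suc k) * - real (j - n)))" for k j
  proof -
    have "nexp (of_nat (Suc k) * of_nat j) = exp (- (real (Suc k) * real j))"
      using nexp_ennreal[of "real (Suc k) * real j"]
      by (simp add: ennreal_mult ennreal_of_nat_eq_real_of_nat del: of_nat_Suc)
    moreover have "(\<Sum>m<n. exp (- (real (Suc k) * real m)) * indicator {of_nat m} (of_nat j :: ennreal))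
        = (if j < n then exp (- (real (Suc k) * real j)) else 0)"
      by (simp add: indicator_def of_bool_def if_distrib cong: if_cong)
    ultimately show ?thesis
      by (auto simp: r_def exp_add[symmetric] of_nat_diff algebra_simps simp del: of_nat_Suc)
  qed
  have int [simp]: "integrable M (\<lambda>x. h x * g x)"
    if [measurable]: "g \<in> borel_measurable M" and "\<And>x. 0 \<le> g x" "\<And>x. g x \<le> 1" for g :: "'a \<Rightarrow> real"
    using h that by (intro integrable_const_bound[where B=1]) (auto simp: abs_mult intro!: mult_le_one)
  have "exp (real (Suc k) * real n) * ((\<integral>x. h x * nexp (of_nat (Suc k) * N x) \<partial>M)
      - (\<Sum>m<n. exp (- (real (Suc k) * real m)) * (\<integral>x. h x * indicator {of_nat m} (N x) \<partial>M)))
    = (\<integral>x. h x * r k (N x) \<partial>M)" for k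
  proof -
    have "(\<integral>x. h x * r k (N x) \<partial>M) = (\<integral>x. exp (real (Suc k) * real n) * (h x * nexp (of_nat (Suc k) * N x)
      - (\<Sum>m<n. exp (- (real (Suc k) * real m)) * (h x * indicator {of_nat m} (N x)))) \<partial>M)"
      by (simp only: r_def right_diff_distrib sum_distrib_left mult_ac)
    also have "\<dots> = exp (real (Suc k) * real n) * ((\<integral>x. h x * nexp (of_nat (Suc k) * N x) \<partial>M)
      - (\<Sum>m<n. exp (- (real (Suc k) * real m)) * (\<integral>x. h x * indicator {of_nat m} (N x) \<partial>M)))"
      by (simp del: of_nat_Suc)
    finally show ?thesis by simp
  qed
  moreover have "(\<lambda>k. \<integral>x. h x * r k (N x) \<partial>M) \<longlonglongrightarrow> (\<integral>x. h x * indicator {of_nat n} (N x) \<partial>M)"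
  proof (rule integral_dominated_convergence[where w="\<lambda>_. 1"])
    show "(\<lambda>x. h x * r k (N x)) \<in> borel_measurable M" for k
      unfolding r_def by measurable
    have "(\<lambda>k. r k (N x)) \<longlonglongrightarrow> indicator {of_nat n} (N x)" if "x \<in> space M" for x
      using N[OF that]
    proof
      assume "\<exists>j::nat. N x = of_nat j"
      then obtain j :: nat where j: "N x = of_nat j" ..
      consider "j < n" | "j = n" | "n < j" by linarith
      then show ?thesis
      proof cases
        case 3
        then have "(\<lambda>k. exp (real (Suc k) * - real (j - n))) \<longlonglongrightarrow> 0"
          using LIMSEQ_Suc[OF LIMSEQ_power_zero[of "exp (- real (j - n))"]]
          by (simp add: exp_of_nat_mult[symmetric] minus_mult_right del: of_nat_Suc power_Suc)
        then show ?thesis using 3 by (simp add: j r_nat del: of_nat_Suc)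
      qed (simp_all add: j r_nat)
    qed simp
    then show "AE x in M. (\<lambda>k. h x * r k (N x)) \<longlonglongrightarrow> h x * indicator {of_nat n} (N x)"
      by (auto intro!: tendsto_intros)
    \<comment> \<open>The surviving exponents are nonpositive, giving a bound uniform in k for
      dominated convergence.\<close>
    have "\<bar>r k (N x)\<bar> \<le> 1" if "x \<in> space M" for k x
      using N[OF that] by (auto simp: r_nat intro!: mult_nonneg_nonpos simp del: of_nat_Suc)
    then show "AE x in M. norm (h x * r k (N x)) \<le> 1" for k
      using h by (auto simp: abs_mult intro!: mult_le_one)
  qed auto
  ultimately show ?thesis by simp
qed

text \<open>Events prescribing finitely many finite counts form an intersection-stable generator of
  the sigma-algebra, so it suffices that P and Q agree on them. Their probabilities are extracted
  one count at a time.\<close>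

lemma laplace_determines_law:
  assumes "prob_space P" "prob_space Q"
    and setsP: "sets P = sets (Gamma Y)" and setsQ: "sets Q = sets (Gamma Y)"
    and laplace: "\<And>f. f \<in> borel_measurable Y \<Longrightarrow> (\<And>y. 0 \<le> f y) \<Longrightarrow>
      (\<integral>\<^sup>+ c. ennreal (nexp (gpair c f)) \<partial>P) = (\<integral>\<^sup>+ c. ennreal (nexp (gpair c f)) \<partial>Q)"
  shows "P = Q"
proof -
  interpret P: prob_space P by fact
  interpret Q: prob_space Q by fact
  have [measurable_cong]: "sets P = sets (Gamma Y)" "sets Q = sets (Gamma Y)" by fact+
  have spaceP: "space P = gconf Y" and spaceQ: "space Q = gconf Y"
    using setsP setsQ by (auto dest!: sets_eq_imp_space_eq simp: space_Gamma)
  \<comment> \<open>The indicator of such an event is written as a product over a list so that one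
    condition can be split off at a time.\<close>
  define W :: "('a set \<times> nat) list \<Rightarrow> ('a \<Rightarrow> enat) \<Rightarrow> real" where
    "W L c = (\<Prod>(B, n)\<leftarrow>L. indicator {of_nat n} (gcount c B))" for L c
  have W_Nil: "W [] c = 1" and W_Cons: "W ((B, n) # L) c = indicator {of_nat n} (gcount c B) * W L c"
    for B n L c by (simp_all add: W_def)
  have W_meas: "fst ` set L \<subseteq> sets Y \<Longrightarrow> W L \<in> borel_measurable (Gamma Y)" for L
  proof (induction L)
    case (Cons a L)
    then have [measurable]: "W L \<in> borel_measurable (Gamma Y)" "fst a \<in> sets Y" by auto
    then show ?case by (cases a) (auto simp: W_Cons[abs_def])
  qed (simp add: W_Nil[abs_def])
  have W_01: "0 \<le> W L c" "W L c \<le> 1" for L c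
    by (induction L) (auto simp: W_Nil W_Cons split: split_indicator)
  have gpair_meas: "(\<lambda>c. gpair c f) \<in> borel_measurable (Gamma Y)" if "f \<in> borel_measurable Y" for f
    unfolding gpair_eq_gint using that by (intro gint_measurable) simp
  \<comment> \<open>The Laplace factor with arbitrary f stays in the claim so that the induction on
    L can vary f. Real integrals are used because the extraction subtracts.\<close>
  have main: "(\<integral>c. nexp (gpair c f) * W L c \<partial>P) = (\<integral>c. nexp (gpair c f) * W L c \<partial>Q)"
    if "fst ` set L \<subseteq> sets Y" "f \<in> borel_measurable Y" "\<And>y. 0 \<le> f y" for L f
    using that
  proof (induction L arbitrary: f)
    case Nil
    note [measurable] = gpair_meas[OF Nil.prems(2)]
    show ?case
      using laplace[OF Nil.prems(2,3)] by (simp add: W_Nil integral_eq_nn_integral)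
  next
    case (Cons a L)
    obtain B n where a: "a = (B, n)" by (cases a)
    have L: "fst ` set L \<subseteq> sets Y" and B [measurable]: "B \<in> sets Y"
      using Cons.prems by (auto simp: a)
    note [measurable] = gpair_meas[OF Cons.prems(2)] W_meas[OF L] Cons.prems(2)
    define h where "h c = nexp (gpair c f) * W L c" for c
    have [measurable]: "h \<in> borel_measurable (Gamma Y)" unfolding h_def[abs_def] by measurable
    have h01: "0 \<le> h c" "h c \<le> 1" for c
      using W_01 by (auto simp: h_def intro!: mult_le_one)
    have shifted: "(\<integral>c. h c * nexp (of_nat (Suc k) * gcount c B) \<partial>P)
      = (\<integral>c. h c * nexp (of_nat (Suc k) * gcount c B) \<partial>Q)" for k
    proof -
      \<comment> \<open>The Laplace weight of the new count is absorbed into the test function, so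
        the induction hypothesis for L applies.\<close>
      let ?f = "\<lambda>y. f y + real (Suc k) * indicator B y"
      have "gpair c ?f = gpair c f + of_nat (Suc k) * gcount c B" for c
        using Cons.prems(3)
        by (simp add: gpair_eq_gint gcount_eq_gint ennreal_plus ennreal_mult gint_add gint_cmult
            ennreal_indicator flip: ennreal_of_nat_eq_real_of_nat del: of_nat_Suc)
      then have "h c * nexp (of_nat (Suc k) * gcount c B) = nexp (gpair c ?f) * W L c" for c
        by (simp add: h_def nexp_add mult_ac del: of_nat_Suc)
      moreover have "(\<integral>c. nexp (gpair c ?f) * W L c \<partial>P) = (\<integral>c. nexp (gpair c ?f) * W L c \<partial>Q)"
        using Cons.prems(3) by (intro Cons.IH L) auto
      ultimately show ?thesis by simp
    qed
    have "(\<integral>c. h c * indicator {of_nat n} (gcount c B) \<partial>P)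
      = (\<integral>c. h c * indicator {of_nat n} (gcount c B) \<partial>Q)"
    proof (induction n rule: less_induct)
      case (less n)
      let ?S = "\<lambda>R k. exp (real (Suc k) * real n) * ((\<integral>c. h c * nexp (of_nat (Suc k) * gcount c B) \<partial>R)
        - (\<Sum>m<n. exp (- (real (Suc k) * real m)) * (\<integral>c. h c * indicator {of_nat m} (gcount c B) \<partial>R)))"
      \<comment> \<open>The Laplace terms agree by \<open>shifted\<close> and the subtracted atoms m
        < n by strong induction on n. Both approximating sequences coincide, hence so do their
        limits.\<close>
      have "?S P k = ?S Q k" for k
        using less.IH shifted[of k] by (simp del: of_nat_Suc)
      moreover have "?S P \<longlonglongrightarrow> (\<integral>c. h c * indicator {of_nat n} (gcount c B) \<partial>P)"
        using h01 gcount_integer[of _ Y B] by (intro P.laplace_extract_atom) (auto simp: spaceP)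
      moreover have "?S Q \<longlonglongrightarrow> (\<integral>c. h c * indicator {of_nat n} (gcount c B) \<partial>Q)"
        using h01 gcount_integer[of _ Y B] by (intro Q.laplace_extract_atom) (auto simp: spaceQ)
      ultimately show ?case by (simp add: LIMSEQ_unique)
    qed
    then show ?case by (simp add: a W_Cons h_def mult_ac)
  qed
  define C where "C L = {c \<in> gconf Y. \<forall>(B, n)\<in>set L. gcount c B = of_nat n}" for L :: "('a set \<times> nat) list"
  define E where "E = C ` {L. fst ` set L \<subseteq> sets Y}"
  have W_C: "W L c = indicator (C L) c" if "c \<in> gconf Y" for L c
  proof (induction L)
    case Nil
    then show ?case using that by (simp add: W_Nil C_def)
  next
    case (Cons a L)
    have "C (a # L) = {c \<in> C L. gcount c (fst a) = of_nat (snd a)}"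
      by (cases a) (auto simp: C_def)
    then show ?case
      using Cons by (cases a) (auto simp: W_Cons indicator_def)
  qed
  have C_sets: "C L \<in> sets (Gamma Y)" if "fst ` set L \<subseteq> sets Y" for L
  proof -
    have "C L \<subseteq> gconf Y" by (auto simp: C_def)
    then have "C L = {c \<in> space (Gamma Y). W L c = 1}"
      by (auto simp: space_Gamma W_C indicator_eq_1_iff)
    also have "\<dots> \<in> sets (Gamma Y)" using W_meas[OF that] by measurable
    finally show ?thesis .
  qed
  have E_sub: "E \<subseteq> Pow (gconf Y)" by (auto simp: E_def C_def)
  have C_Nil: "gconf Y \<in> E"
    unfolding E_def by (rule image_eqI[of _ _ "[]"]) (auto simp: C_def)
  have sigma_E: "sets (Gamma Y) = sigma_sets (gconf Y) E"
  proof
    interpret S: sigma_algebra "gconf Y" "sigma_sets (gconf Y) E"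
      using E_sub by (rule sigma_algebra_sigma_sets)
    have atom: "{c \<in> gconf Y. gcount c B = of_nat n} \<in> sigma_sets (gconf Y) E" if "B \<in> sets Y" for B n
    proof -
      have "{c \<in> gconf Y. gcount c B = of_nat n} = C [(B, n)]" by (auto simp: C_def)
      then show ?thesis using that by (auto simp: E_def)
    qed
    have "{c \<in> gconf Y. gcount c B \<in> A} \<in> sigma_sets (gconf Y) E" if B: "B \<in> sets Y" for B A
    proof -
      have atoms: "(\<Union>n\<in>I. {c \<in> gconf Y. gcount c B = of_nat n}) \<in> sigma_sets (gconf Y) E" for I :: "nat set"
        using B by (intro S.countable_UN'') (auto intro: atom)
      \<comment> \<open>The events in E prescribe only finite counts; an infinite count is captured
        as the complement of a countable union of atoms.\<close>
      have "{c \<in> gconf Y. gcount c B \<in> A} =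
        (if \<infinity> \<in> A then gconf Y - (\<Union>n\<in>{n. of_nat n \<notin> A}. {c \<in> gconf Y. gcount c B = of_nat n})
         else (\<Union>n\<in>{n. of_nat n \<in> A}. {c \<in> gconf Y. gcount c B = of_nat n}))"
        using gcount_integer[of _ Y B] by (auto, metis+)
      then show ?thesis using atoms S.top S.Diff by simp
    qed
    then show "sets (Gamma Y) \<subseteq> sigma_sets (gconf Y) E"
      unfolding Gamma_def by (subst sets_measure_of) (auto intro!: S.sigma_sets_subset)
    show "sigma_sets (gconf Y) E \<subseteq> sets (Gamma Y)"
      using C_sets by (auto simp: E_def space_Gamma[symmetric] intro!: sets.sigma_sets_subset)
  qed
  show "P = Q"
  proof (rule measure_eqI_generator_eq[where \<Omega>="gconf Y" and E=E and A="\<lambda>_. gconf Y"])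
    show "Int_stable E"
    proof (rule Int_stableI)
      fix X X' assume "X \<in> E" "X' \<in> E"
      then obtain L L' where L: "fst ` set L \<subseteq> sets Y" "fst ` set L' \<subseteq> sets Y" and X: "X = C L" "X' = C L'"
        by (auto simp: E_def)
      have "X \<inter> X' = C (L @ L')" by (auto simp: X C_def)
      moreover have "L @ L' \<in> {L. fst ` set L \<subseteq> sets Y}" using L by auto
      ultimately show "X \<inter> X' \<in> E" unfolding E_def by simp
    qed
    fix X assume "X \<in> E"
    then obtain L where L: "fst ` set L \<subseteq> sets Y" and X: "X = C L" by (auto simp: E_def)
    have gpair_0: "gpair c (\<lambda>_. 0) = 0" for c by (simp add: gpair_def)
    have "(\<integral>c. W L c \<partial>R) = measure R X" if "space R = gconf Y" "sets R = sets (Gamma Y)" for R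
    proof -
      have "(\<integral>c. W L c \<partial>R) = (\<integral>c. indicator X c \<partial>R)"
        using that by (intro Bochner_Integration.integral_cong) (auto simp: W_C X)
      then show ?thesis using sets.sets_into_space[OF C_sets[OF L]] that
        by (simp add: X space_Gamma Int_absorb2)
    qed
    \<comment> \<open>With f = 0 the Laplace factor is 1, and \<open>main\<close> compares the
      probabilities of X itself.\<close>
    then have "measure P X = measure Q X"
      using main[OF L, of "\<lambda>_. 0"] spaceP spaceQ setsP setsQ by (simp add: gpair_0)
    then show "emeasure P X = emeasure Q X"
      by (simp add: P.emeasure_eq_measure Q.emeasure_eq_measure)
  qed (use E_sub C_Nil sigma_E setsP setsQ in auto)
qed

section \<open>The cluster space and the maps \<open>pt\<close>, \<open>ppmap\<close> and
  \<open>shift\<close>\<close>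

lemma measurable_fst_XXM [measurable]: "fst \<in> measurable XXM (count_space UNIV)"
  unfolding XXM_def by (rule measurable_restrict_space1) simp

lemma measurable_snd_XXM [measurable]: "(\<lambda>x. snd x i) \<in> measurable XXM borel"
  unfolding XXM_def by (rule measurable_restrict_space1) measurable

lemma gint_pt_measurable:
  fixes g :: "'a::{zero,topological_space} \<Rightarrow> ennreal"
  assumes [measurable]: "g \<in> borel_measurable borel"
  shows "(\<lambda>x. gint (pt x) g) \<in> borel_measurable XXM"
  unfolding gint_pt nn_integral_count_space_nat by measurable

lemma pt_in_gconf: "pt x \<in> gconf (borel :: 'a::topological_space measure)"
proof -
  have "pt x y = 0" if "y \<notin> range (snd x)" for y
  proof -
    have "{i. enat i < fst x \<and> snd x i = y} = {}" using that by auto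
    then show ?thesis unfolding pt_def Let_def by (simp only:) (simp add: zero_enat_def)
  qed
  then have "{y. pt x y \<noteq> 0} \<subseteq> range (snd x)" by blast
  from countable_subset[OF this] show ?thesis by (simp add: gconf_def)
qed

lemma pt_measurable [measurable]:
  "pt \<in> measurable XXM (Gamma (borel :: 'a::{zero,topological_space} measure))"
proof (rule measurable_into_Gamma)
  fix B :: "'a set" assume "B \<in> sets borel"
  then show "(\<lambda>x. gcount (pt x) B) \<in> borel_measurable XXM"
    unfolding gcount_eq_gint by (intro gint_pt_measurable borel_measurable_indicator)
qed (rule pt_in_gconf)

text \<open>A point of the superposition lies in one of the countably many clusters present, each of
  which has countable support.\<close>

lemma ppmap_in_gconf:
  assumes "c \<in> gconf Y"
  shows "ppmap c \<in> gconf (borel :: 'a::topological_space measure)"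
proof -
  have "ppmap c y = 0" if "\<And>x. c x \<noteq> 0 \<Longrightarrow> pt x y = 0" for y
  proof -
    have "c x * pt x y = 0" for x using that[of x] by (cases "c x = 0") auto
    then have sum_0: "(\<Sum>x\<in>F. c x * pt x y) = 0" for F by (intro sum.neutral ballI)
    have "{F :: (enat \<times> (nat \<Rightarrow> 'a)) set. finite F} \<noteq> {}" by (auto intro: exI[of _ "{}"])
    then show ?thesis unfolding ppmap_def sum_0 by (rule SUP_const)
  qed
  then have "{y. ppmap c y \<noteq> 0} \<subseteq> (\<Union>x\<in>{x. c x \<noteq> 0}. {y. pt x y \<noteq> 0})" by blast
  moreover have "countable (\<Union>x\<in>{x. c x \<noteq> 0}. {y. pt x y \<noteq> 0})"
    using assms pt_in_gconf by (intro countable_UN) (auto simp: gconf_def)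
  ultimately have "countable {y. ppmap c y \<noteq> 0}" by (rule countable_subset)
  then show ?thesis by (simp add: gconf_def)
qed

text \<open>By \<open>gint_ppmap\<close>, counting B in the superposition is pairing c with the
  number of cluster points in B, a measurable function on \<open>XXM\<close>.\<close>

lemma ppmap_measurable:
  "ppmap \<in> measurable (Gamma XXM) (Gamma (borel :: 'a::{zero,topological_space} measure))"
proof (rule measurable_into_Gamma)
  fix B :: "'a set" assume "B \<in> sets borel"
  then have "(\<lambda>c. gint c (\<lambda>x. gint (pt x) (indicator B))) \<in> borel_measurable (Gamma XXM)"
    by (intro gint_measurable gint_pt_measurable) simp
  then show "(\<lambda>c. gcount (ppmap c) B) \<in> borel_measurable (Gamma XXM)"
    by (rule measurable_cong[THEN iffD1, rotated])
      (simp add: gcount_eq_gint gint_ppmap[of _ XXM] space_Gamma)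
qed (auto simp: space_Gamma intro: ppmap_in_gconf)

lemma shift_measurable:
  assumes "continuous_on UNIV (\<lambda>p::'a \<times> 'a. fst p + snd p)"
  shows "(\<lambda>(x, y). shift y x)
    \<in> measurable (borel \<Otimes>\<^sub>M XXM) (XXM :: (enat \<times> (nat \<Rightarrow> 'a::{polish_space, real_vector})) measure)"
proof -
  \<comment> \<open>Continuity of addition is a hypothesis here, not a class property. On a second
    countable space it yields Borel measurability of sums, registered for the measurability
    prover.\<close>
  have [measurable (raw)]: "(\<lambda>z. f z + g z) \<in> borel_measurable M"
    if "f \<in> borel_measurable M" "g \<in> borel_measurable M"
    for f g :: "'c \<Rightarrow> 'a" and M
    using that assms by (rule borel_measurable_continuous_Pair)
  have [measurable]: "(\<lambda>z. fst (snd z)) \<in> measurable (borel \<Otimes>\<^sub>M XXM) (count_space UNIV)"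
    "(\<lambda>z. snd (snd z) i) \<in> borel_measurable (borel \<Otimes>\<^sub>M XXM)"
    for i by measurable
  have "(\<lambda>z. (fst (snd z), \<lambda>i. if enat i < fst (snd z) then snd (snd z) i + fst z else 0))
    \<in> measurable (borel \<Otimes>\<^sub>M XXM) (count_space UNIV \<Otimes>\<^sub>M (\<Pi>\<^sub>M i\<in>(UNIV::nat set). (borel :: 'a measure)))"
    by (intro measurable_Pair measurable_PiM_single') (auto simp: space_PiM)
  \<comment> \<open>Since \<open>shift\<close> puts 0 beyond the length of the sequence, its image
    stays in \<open>XXspace\<close>.\<close>
  then show ?thesis
    unfolding XXM_def shift_def case_prod_beta
    by (intro measurable_restrict_space2) (auto simp: XXspace_def XXM_def[symmetric])
qed

text \<open>The set function defining \<open>lamstar\<close> is the slice formula for the product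
  measure of preimages under the shift. Both sides are \<open>measure_of\<close> applied to set
  functions that agree on \<open>XXM\<close>, so \<open>lamstar\<close> inherits countable
  additivity from the image measure.\<close>

lemma lamstar_eq_distr:
  fixes lam :: "'a::{polish_space, real_vector} measure"
  assumes add: "continuous_on UNIV (\<lambda>p::'a \<times> 'a. fst p + snd p)"
    and lam: "sets lam = sets borel"
    and eta: "sigma_finite_measure eta" "sets eta = sets XXM"
  shows "lamstar lam eta = distr (lam \<Otimes>\<^sub>M eta) XXM (\<lambda>(x, y). shift y x)"
  unfolding lamstar_def distr_def
proof (rule measure_of_eq)
  interpret sigma_finite_measure eta by fact
  fix B :: "(enat \<times> (nat \<Rightarrow> 'a)) set" assume "B \<in> sigma_sets (space XXM) (sets XXM)"
  then have B: "B \<in> sets XXM" by (simp add: sets.sigma_sets_eq)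
  have "(\<lambda>(x, y). shift y x) \<in> measurable (lam \<Otimes>\<^sub>M eta) XXM"
    using shift_measurable[OF add] lam eta(2) by (simp cong: measurable_cong_sets sets_pair_measure_cong)
  then have "(\<lambda>(x, y). shift y x) -` B \<inter> space (lam \<Otimes>\<^sub>M eta) \<in> sets (lam \<Otimes>\<^sub>M eta)"
    using B by (rule measurable_sets)
  then show "(\<integral>\<^sup>+ x. emeasure eta {y \<in> space XXM. shift y x \<in> B} \<partial>lam)
    = emeasure (lam \<Otimes>\<^sub>M eta) ((\<lambda>(x, y). shift y x) -` B \<inter> space (lam \<Otimes>\<^sub>M eta))"
    using sets_eq_imp_space_eq[OF lam] sets_eq_imp_space_eq[OF eta(2)]
    by (subst emeasure_pair_measure_alt)
      (auto simp: space_pair_measure vimage_def intro!: nn_integral_cong arg_cong[where f="emeasure eta"])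
qed (rule sets.space_closed)

section \<open>The Poisson cluster measure as an image of the Poisson measure\<close>

theorem mainTheorem10:
  fixes lam :: "'a::{polish_space, real_vector} measure"
    and eta :: "(enat \<times> (nat \<Rightarrow> 'a)) measure"
    and P :: "(enat \<times> (nat \<Rightarrow> 'a) \<Rightarrow> enat) measure"
    and mucl :: "('a \<Rightarrow> enat) measure"
  assumes tvs_add: "continuous_on UNIV (\<lambda>p::'a \<times> 'a. fst p + snd p)"
    and tvs_scale: "continuous_on UNIV (\<lambda>p::real \<times> 'a. fst p *\<^sub>R snd p)"
    and lam_sets: "sets lam = sets (borel :: 'a measure)"
    and lam_sfin: "sigma_finite_measure lam"
    and eta_prob: "prob_space eta"
    and eta_sets: "sets eta = sets XXM"
    and eta_sym: "perm_symmetric eta"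
    and integr: "\<And>B. B \<in> sets (borel :: 'a measure) \<Longrightarrow> emeasure lam B < \<infinity> \<Longrightarrow>
        (\<integral>\<^sup>+ c. emeasure lam (droplet B c) \<partial>(distr eta (Gamma borel) pt)) < \<infinity>"
    and P_poisson: "is_poisson XXM (lamstar lam eta) P"
    and mucl_def: "is_cluster lam (distr eta (Gamma borel) pt) mucl"
  shows "ppmap \<in> measurable (Gamma XXM) (Gamma (borel :: 'a measure))
         \<and> distr P (Gamma (borel :: 'a measure)) ppmap = mucl"
proof
  show "ppmap \<in> measurable (Gamma XXM) (Gamma (borel :: 'a measure))"
    by (rule ppmap_measurable)
  interpret eta: prob_space eta by fact
  have setsP: "sets P = sets (Gamma XXM)" and probP: "prob_space P"
    using P_poisson by (auto simp: is_poisson_def)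
  have [measurable_cong]: "sets lam = sets borel" "sets eta = sets XXM" by fact+
  have ppmap_P [measurable]: "ppmap \<in> measurable P (Gamma (borel :: 'a measure))"
    using ppmap_measurable setsP by (simp cong: measurable_cong_sets)
  have shift [measurable]: "(\<lambda>(x, y). shift y x) \<in> measurable (lam \<Otimes>\<^sub>M eta) XXM"
    using shift_measurable[OF tvs_add] by measurable
  show "distr P (Gamma (borel :: 'a measure)) ppmap = mucl"
  proof (rule laplace_determines_law[where Y=borel])
    show "prob_space (distr P (Gamma (borel :: 'a measure)) ppmap)"
      by (rule prob_space.prob_space_distr[OF probP ppmap_P])
    show "prob_space mucl" "sets mucl = sets (Gamma borel)"
      using mucl_def by (auto simp: is_cluster_def)
    fix f :: "'a \<Rightarrow> real" assume f [measurable]: "f \<in> borel_measurable borel" and f_nonneg: "\<And>y. 0 \<le> f y"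
    define g where "g x = gint (pt x) (\<lambda>y. ennreal (f y))" for x
    have g [measurable]: "g \<in> borel_measurable XXM"
      unfolding g_def[abs_def] by (rule gint_pt_measurable) simp
    have gpair_meas: "(\<lambda>c. gpair c k) \<in> borel_measurable (Gamma borel)"
      if "k \<in> borel_measurable borel" for k :: "'a \<Rightarrow> real"
      unfolding gpair_eq_gint using that by (intro gint_measurable) simp
    note [measurable] = gpair_meas[OF f]
    \<comment> \<open>Shifting the cluster amounts to translating the test function, which is how
      the translated f in \<open>is_cluster\<close> arises.\<close>
    have g_shift: "g (shift y x) = gpair (pt y) (\<lambda>z. f (z + x))" for x y
      by (simp add: g_def gpair_eq_gint gint_pt shift_def cong: if_cong)
    have "(\<integral>\<^sup>+ c. ennreal (nexp (gpair c f)) \<partial>distr P (Gamma borel) ppmap)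
      = (\<integral>\<^sup>+ c. ennreal (nexp (gpair (ppmap c) f)) \<partial>P)"
      by (subst nn_integral_distr) auto
    also have "\<dots> = (\<integral>\<^sup>+ c. ennreal (nexp (gint c g)) \<partial>P)"
      using sets_eq_imp_space_eq[OF setsP]
      by (intro nn_integral_cong) (simp add: space_Gamma gpair_eq_gint g_def[abs_def] gint_ppmap[of _ XXM])
    \<comment> \<open>An infinite cluster can make g infinite, hence the extended form of the
      Poisson Laplace functional.\<close>
    also have "\<dots> = ennreal (nexp (\<integral>\<^sup>+ y. ennreal (1 - nexp (g y)) \<partial>lamstar lam eta))"
      by (rule poisson_laplace_ennreal[OF P_poisson _ g]) (simp add: lamstar_def)
    also have "(\<integral>\<^sup>+ y. ennreal (1 - nexp (g y)) \<partial>lamstar lam eta)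
      = (\<integral>\<^sup>+ z. ennreal (1 - nexp (g (case z of (x, y) \<Rightarrow> shift y x))) \<partial>(lam \<Otimes>\<^sub>M eta))"
      by (subst lamstar_eq_distr[OF tvs_add lam_sets eta.sigma_finite_measure_axioms eta_sets])
        (subst nn_integral_distr, auto)
    also have "\<dots> = (\<integral>\<^sup>+ x. \<integral>\<^sup>+ y. ennreal (1 - nexp (g (shift y x))) \<partial>eta \<partial>lam)"
      by (subst eta.nn_integral_fst[symmetric]) auto
    also have "\<dots> = (\<integral>\<^sup>+ x. \<integral>\<^sup>+ c. ennreal (1 - nexp (gpair c (\<lambda>z. f (z + x))))
        \<partial>distr eta (Gamma borel) pt \<partial>lam)"
    proof (intro nn_integral_cong)
      fix x :: 'a
      \<comment> \<open>For fixed x the translate of f must be Borel for the change of variables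
        along \<open>pt\<close>.\<close>
      have "(\<lambda>z. z + x) \<in> borel_measurable borel"
        by (rule borel_measurable_continuous_Pair[where f="\<lambda>z::'a. z" and g="\<lambda>_. x" and H="(+)", OF _ _ tvs_add]) auto
      then have [measurable]: "(\<lambda>z. f (z + x)) \<in> borel_measurable borel" by measurable
      note [measurable] = gpair_meas[OF this]
      show "(\<integral>\<^sup>+ y. ennreal (1 - nexp (g (shift y x))) \<partial>eta)
        = (\<integral>\<^sup>+ c. ennreal (1 - nexp (gpair c (\<lambda>z. f (z + x)))) \<partial>distr eta (Gamma borel) pt)"
        by (subst nn_integral_distr) (auto simp: g_shift)
    qed
    also have "ennreal (nexp \<dots>) = (\<integral>\<^sup>+ c. ennreal (nexp (gpair c f)) \<partial>mucl)"
      using mucl_def f f_nonneg by (simp add: is_cluster_def)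
    finally show "(\<integral>\<^sup>+ c. ennreal (nexp (gpair c f)) \<partial>distr P (Gamma borel) ppmap)
      = (\<integral>\<^sup>+ c. ennreal (nexp (gpair c f)) \<partial>mucl)" .
  qed simp
qed

end
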